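(* There does not exist a nontrivial (i.e. nonconstant) radially symmetric smooth harmonic map from the whole plane $\mathbf{R}^2$ to the hyperbolic plane $\mathbf{H}^2$.
   Context: $\mathbf{R}^2$ carries the Euclidean metric. $\mathbf{H}^2$ is the hyperbolic plane, realized as one sheet of the hyperboloid $\{(s_1,s_2,s_3): s_1^2+s_2^2-s_3^2=-1\}$ in the Minkowski space $\mathbf{R}^{2+1}$ (metric $ds_1^2+ds_2^2-ds_3^2$) with the induced Riemannian metric. A map $S:\mathbf{R}^2\to\mathbf{H}^2$ is radially symmetric if it depends only on the radial variable, $S=S(\rho)$ with $\rho=\sqrt{x_1^2+x_2^2}$. *)

theory Defs
  imports "HOL-Analysis.Analysis"
begin

subsection \<open>The hyperboloid model of the hyperbolic plane\<close>

definition minkowski :: "real ^ 3 \<Rightarrow> real ^ 3 \<Rightarrow> real" where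
  "minkowski u v = u $ 1 * v $ 1 + u $ 2 * v $ 2 - u $ 3 * v $ 3"

definition hyperbolic_plane :: "(real ^ 3) set" where
  "hyperbolic_plane = {s. minkowski s s = -1 \<and> s $ 3 > 0}"

text \<open>The tangent space of the hyperboloid at \<^term>\<open>p\<close> is the Minkowski-orthogonal complement
  of \<^term>\<open>p\<close>. As \<^term>\<open>minkowski p p = -1\<close>, the orthogonal projection onto it carries a plus sign;
  see \<open>tangential_part_unique\<close> below.\<close>

definition tangent_space :: "real ^ 3 \<Rightarrow> (real ^ 3) set" where
  "tangent_space p = {v. minkowski p v = 0}"

definition tangential_part :: "real ^ 3 \<Rightarrow> real ^ 3 \<Rightarrow> real ^ 3" where
  "tangential_part p v = v + minkowski p v *\<^sub>R p"


subsection \<open>Smooth maps\<close>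

definition dir_deriv :: "('a::real_normed_vector \<Rightarrow> 'b::real_normed_vector) \<Rightarrow> 'a \<Rightarrow> 'a \<Rightarrow> 'b" where
  "dir_deriv f v x = frechet_derivative f (at x) v"

fun times_differentiable :: "nat \<Rightarrow> ('a::real_normed_vector \<Rightarrow> 'b::real_normed_vector) \<Rightarrow> bool" where
  "times_differentiable 0 f \<longleftrightarrow> continuous_on UNIV f"
| "times_differentiable (Suc k) f \<longleftrightarrow>
     (\<forall>x. f differentiable (at x)) \<and> (\<forall>v. times_differentiable k (dir_deriv f v))"

text \<open>A map into the hyperboloid, which is an embedded submanifold, is smooth iff it is smooth
  as a map into the ambient space.\<close>

definition smooth :: "('a::real_normed_vector \<Rightarrow> 'b::real_normed_vector) \<Rightarrow> bool" where
  "smooth f \<longleftrightarrow> (\<forall>k. times_differentiable k f)"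


subsection \<open>Harmonic maps\<close>

text \<open>The Levi-Civita connection of the induced metric is the tangential part of the flat
  connection of the ambient Minkowski space. So \<open>cov_deriv S V e\<close> is the covariant derivative, in
  the pulled back tangent bundle, of the vector field \<^term>\<open>V\<close> along \<^term>\<open>S\<close>. The tension field is
  the trace of the second fundamental form \<open>\<nabla>dS\<close>; the domain being flat, it is the sum of the
  \<open>\<nabla>\<^sub>e (dS e)\<close> over the standard orthonormal frame.\<close>

definition cov_deriv ::
  "(real ^ 2 \<Rightarrow> real ^ 3) \<Rightarrow> (real ^ 2 \<Rightarrow> real ^ 3) \<Rightarrow> real ^ 2 \<Rightarrow> real ^ 2 \<Rightarrow> real ^ 3" where
  "cov_deriv S V e x = tangential_part (S x) (dir_deriv V e x)"

definition tension_field :: "(real ^ 2 \<Rightarrow> real ^ 3) \<Rightarrow> real ^ 2 \<Rightarrow> real ^ 3" where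
  "tension_field S x = (\<Sum>e\<in>Basis. cov_deriv S (dir_deriv S e) e x)"

definition harmonic_map :: "(real ^ 2 \<Rightarrow> real ^ 3) \<Rightarrow> bool" where
  "harmonic_map S \<longleftrightarrow> (\<forall>x. tension_field S x = 0)"

definition radially_symmetric :: "(real ^ 2 \<Rightarrow> real ^ 3) \<Rightarrow> bool" where
  "radially_symmetric S \<longleftrightarrow> (\<exists>f :: real \<Rightarrow> real ^ 3. \<forall>x. S x = f (norm x))"


subsection \<open>Consistency of the definitions\<close>

lemma bounded_bilinear_minkowski: "bounded_bilinear minkowski"
proof -
  have e: "minkowski = (\<lambda>u v. (\<chi> i. if i = 3 then - u $ 3 else u $ i) \<bullet> v)"
    by (auto simp: minkowski_def inner_vec_def sum_3 fun_eq_iff)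
  have "bounded_linear (\<lambda>u :: real ^ 3. (\<chi> i. if i = 3 then - u $ 3 else u $ i) :: real ^ 3)"
    by (rule linear_conv_bounded_linear[THEN iffD1], rule linearI) (auto simp: vec_eq_iff)
  from bounded_bilinear.comp[OF bounded_bilinear_inner this bounded_linear_ident]
  show ?thesis unfolding e by simp
qed

lemma minkowski_commute: "minkowski u v = minkowski v u"
  by (simp add: minkowski_def)

lemma tangential_part_unique:
  assumes "p \<in> hyperbolic_plane"
  shows "w = tangential_part p v \<longleftrightarrow>
         w \<in> tangent_space p \<and> (\<forall>t\<in>tangent_space p. minkowski (v - w) t = 0)"
proof -
  interpret bounded_bilinear minkowski by (rule bounded_bilinear_minkowski)
  have p: "minkowski p p = -1" using assms by (simp add: hyperbolic_plane_def)
  have 1: "tangential_part p v \<in> tangent_space p"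
    by (simp add: tangent_space_def tangential_part_def add_right scaleR_right p)
  have 2: "minkowski (v - tangential_part p v) t = 0" if "t \<in> tangent_space p" for t
    using that by (simp add: tangent_space_def tangential_part_def minus_left scaleR_left)
  show ?thesis
  proof (intro iffI conjI ballI)
    assume w: "w \<in> tangent_space p \<and> (\<forall>t\<in>tangent_space p. minkowski (v - w) t = 0)"
    define d where "d = tangential_part p v - w"
    have d: "d \<in> tangent_space p"
      using 1 w by (simp add: d_def tangent_space_def diff_right)
    have orth: "minkowski d t = 0" if "t \<in> tangent_space p" for t
      using 2[OF that] w that by (auto simp: d_def diff_left)
    have all0: "minkowski d t = 0" for t
    proof -
      have "tangential_part p t \<in> tangent_space p"
        by (simp add: tangent_space_def tangential_part_def add_right scaleR_right p)
      then have "minkowski d (t + minkowski p t *\<^sub>R p) = 0"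
        using orth by (simp add: tangential_part_def)
      then show ?thesis
        using d by (simp add: add_right scaleR_right tangent_space_def minkowski_commute[of d p])
    qed
    have "minkowski d (\<chi> i. if i = 3 then - d $ 3 else d $ i) = 0"
      by (rule all0)
    then have "(d $ 1)\<^sup>2 + (d $ 2)\<^sup>2 + (d $ 3)\<^sup>2 = 0"
      by (simp add: minkowski_def power2_eq_square)
    then have "d $ 1 = 0 \<and> d $ 2 = 0 \<and> d $ 3 = 0"
      by (smt (verit) zero_le_power2 power_eq_0_iff)
    then have "d = 0"
      by (simp add: vec_eq_iff forall_3)
    then show "w = tangential_part p v"
      by (simp add: d_def)
  qed (use 1 2 in auto)
qed

lemma cov_deriv_metric_compatible:
  assumes "\<And>y. V y \<in> tangent_space (S y)" "\<And>y. W y \<in> tangent_space (S y)"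
    and "V differentiable (at x)" "W differentiable (at x)"
  shows "dir_deriv (\<lambda>y. minkowski (V y) (W y)) e x =
         minkowski (cov_deriv S V e x) (W x) + minkowski (V x) (cov_deriv S W e x)"
proof -
  interpret bounded_bilinear minkowski by (rule bounded_bilinear_minkowski)
  have "((\<lambda>y. minkowski (V y) (W y)) has_derivative
      (\<lambda>h. minkowski (V x) (frechet_derivative W (at x) h) +
           minkowski (frechet_derivative V (at x) h) (W x))) (at x)"
    using assms(3,4) by (intro FDERIV) (auto simp: frechet_derivative_works)
  from frechet_derivative_at[OF this, symmetric] show ?thesis
    using assms(1,2)[of x]
    by (simp add: dir_deriv_def cov_deriv_def tangential_part_def tangent_space_def
        add_left add_right scaleR_left scaleR_right minkowski_commute[of "V x" "S x"])
qed

end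

theory Submission
  imports Defs
begin

text \<open>Restrict \<open>S\<close> to a line through the origin, \<open>F t = S (t e\<^sub>1)\<close>. Rotation invariance says
  \<open>x\<^sub>2 \<partial>\<^sub>1 S = x\<^sub>1 \<partial>\<^sub>2 S\<close>; differentiating this along \<open>e\<^sub>2\<close> yields \<open>F' t = t \<partial>\<^sub>2\<partial>\<^sub>2 S (t e\<^sub>1)\<close>, so that
  harmonicity becomes \<open>t \<nabla>F' + F' = 0\<close>. Hence \<open>t\<^sup>2 \<langle>F', F'\<rangle>\<close> is constant and, vanishing at the origin,
  it is zero. As the metric is positive definite on tangent vectors, \<open>F' = 0\<close>.\<close>

lemma smooth_differentiable:
  assumes "smooth f"
  shows "f differentiable (at x)"
  using assms times_differentiable.simps(2)[of 0 f] unfolding smooth_def by blast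

lemma smooth_dir_deriv:
  assumes "smooth f"
  shows "smooth (dir_deriv f v)"
  using assms times_differentiable.simps(2)[of _ f] unfolding smooth_def by blast

text \<open>The chain rule that reduces the argument to one-variable calculus. It is applied along
  the rotation orbit of a point, along vertical lines and along the first axis.\<close>

lemma has_vector_derivative_along_curve:
  assumes "f differentiable (at (c t))" "(c has_vector_derivative v) (at t)"
  shows "((\<lambda>t. f (c t)) has_vector_derivative dir_deriv f v (c t)) (at t)"
proof -
  have "(f has_derivative frechet_derivative f (at (c t))) (at (c t))"
    using assms(1) by (simp add: frechet_derivative_works)
  from diff_chain_at[OF assms(2)[unfolded has_vector_derivative_def] this]
  show ?thesis
    using linear_frechet_derivative[OF assms(1)]
    by (simp add: has_vector_derivative_def dir_deriv_def o_def linear_scale)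
qed

text \<open>Lagrange's identity, combined with the equations for \<open>p\<close> and
  \<open>v\<close>, collapses to a sum of two squares, one of them \<open>(v $ 3)\<^sup>2\<close>,
  being zero. This is the definiteness of the induced metric that the indefinite ambient form
  lacks.\<close>

lemma minkowski_null_tangent_eq_0:
  assumes p: "p \<in> hyperbolic_plane" and v: "v \<in> tangent_space p" and null: "minkowski v v = 0"
  shows "v = 0"
proof -
  have p': "(p $ 1)\<^sup>2 + (p $ 2)\<^sup>2 = (p $ 3)\<^sup>2 - 1"
    using p by (simp add: hyperbolic_plane_def minkowski_def power2_eq_square)
  have v': "p $ 1 * v $ 1 + p $ 2 * v $ 2 = p $ 3 * v $ 3"
    using v by (simp add: tangent_space_def minkowski_def)
  have n: "(v $ 1)\<^sup>2 + (v $ 2)\<^sup>2 = (v $ 3)\<^sup>2"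
    using null by (simp add: minkowski_def power2_eq_square)
  have "((p $ 1)\<^sup>2 + (p $ 2)\<^sup>2) * ((v $ 1)\<^sup>2 + (v $ 2)\<^sup>2) =
      (p $ 1 * v $ 1 + p $ 2 * v $ 2)\<^sup>2 + (p $ 1 * v $ 2 - p $ 2 * v $ 1)\<^sup>2"
    by (simp add: power2_eq_square algebra_simps)
  then have "(p $ 1 * v $ 2 - p $ 2 * v $ 1)\<^sup>2 + (v $ 3)\<^sup>2 = 0"
    unfolding p' n v' by (simp add: power2_eq_square algebra_simps)
  then have "v $ 3 = 0"
    by (smt (verit) zero_le_power2 power_eq_0_iff)
  with n have "v $ 1 = 0" "v $ 2 = 0"
    by (simp_all add: sum_power2_eq_zero_iff)
  with \<open>v $ 3 = 0\<close> show ?thesis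
    by (simp add: vec_eq_iff forall_3)
qed

lemma dir_deriv_in_tangent_space:
  assumes S: "\<And>x. S x \<in> hyperbolic_plane" and d: "S differentiable (at x)"
  shows "dir_deriv S v x \<in> tangent_space (S x)"
proof -
  interpret bounded_bilinear minkowski by (rule bounded_bilinear_minkowski)
  have "((\<lambda>y. minkowski (S y) (S y)) has_derivative
      (\<lambda>h. minkowski (S x) (frechet_derivative S (at x) h) +
           minkowski (frechet_derivative S (at x) h) (S x))) (at x)"
    using d by (intro FDERIV) (auto simp: frechet_derivative_works)
  moreover have "((\<lambda>y. minkowski (S y) (S y)) has_derivative (\<lambda>h. 0)) (at x)"
    using S by (simp add: hyperbolic_plane_def)
  ultimately have "(\<lambda>h. minkowski (S x) (frechet_derivative S (at x) h) +
           minkowski (frechet_derivative S (at x) h) (S x)) = (\<lambda>h. 0)"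
    by (rule has_derivative_unique)
  from fun_cong[OF this, of v] show ?thesis
    by (simp add: tangent_space_def dir_deriv_def minkowski_commute[of _ "S x"])
qed

lemma radially_symmetric_rotation:
  fixes S :: "real ^ 2 \<Rightarrow> real ^ 3"
  assumes rad: "radially_symmetric S" and d: "S differentiable (at x)"
  shows "x $ 2 *\<^sub>R dir_deriv S (axis 1 1) x = x $ 1 *\<^sub>R dir_deriv S (axis 2 1) x"
proof -
  \<comment> \<open>\<open>J\<close> is \<open>x\<close> turned by a right angle, so
    \<open>c\<close> runs through the circle about the origin on which \<open>x\<close> lies, and
    \<open>S\<close> is constant along it.\<close>
  define J :: "real ^ 2" where "J = x $ 1 *\<^sub>R axis 2 1 - x $ 2 *\<^sub>R axis 1 1"
  define c where "c = (\<lambda>t. cos t *\<^sub>R x + sin t *\<^sub>R J)"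
  have J: "J $ 1 = - (x $ 2)" "J $ 2 = x $ 1"
    by (simp_all add: J_def axis_def)
  have "(cos t * x $ 1 - sin t * x $ 2)\<^sup>2 + (cos t * x $ 2 + sin t * x $ 1)\<^sup>2 =
        ((cos t)\<^sup>2 + (sin t)\<^sup>2) * ((x $ 1)\<^sup>2 + (x $ 2)\<^sup>2)" for t
    unfolding power2_eq_square by algebra
  then have "norm (c t) = norm x" for t
    by (simp add: norm_vec_def L2_set_def sum_2 c_def J)
  then have const: "S (c t) = S x" for t
    using rad by (metis radially_symmetric_def)
  have c0: "c 0 = x" by (simp add: c_def)
  have "(c has_vector_derivative J) (at 0)"
    unfolding c_def by (auto intro!: derivative_eq_intros)
  from has_vector_derivative_along_curve[OF _ this, of S]
  have "((\<lambda>t. S (c t)) has_vector_derivative dir_deriv S J x) (at 0)"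
    using d by (simp add: c0)
  then have "dir_deriv S J x = 0"
    using vector_derivative_unique_at[OF _ has_vector_derivative_const] by (simp add: const)
  then show ?thesis
    using linear_frechet_derivative[OF d]
    by (simp add: dir_deriv_def J_def linear_diff linear_scale)
qed

lemma radially_symmetric_angular_second_derivative:
  fixes S :: "real ^ 2 \<Rightarrow> real ^ 3"
  assumes smooth: "smooth S" and rad: "radially_symmetric S"
  shows "dir_deriv S (axis 1 1) (t *\<^sub>R axis 1 1) =
         t *\<^sub>R dir_deriv (dir_deriv S (axis 2 1)) (axis 2 1) (t *\<^sub>R axis 1 1)"
proof -
  define c :: "real \<Rightarrow> real ^ 2" where "c = (\<lambda>s. t *\<^sub>R axis 1 1 + s *\<^sub>R axis 2 1)"
  have c: "c s $ 1 = t" "c s $ 2 = s" "c 0 = t *\<^sub>R axis 1 1" for s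
    by (simp_all add: c_def axis_def)
  have c': "(c has_vector_derivative axis 2 1) (at s)" for s
    unfolding c_def by (auto intro!: derivative_eq_intros)
  have D: "((\<lambda>s. dir_deriv S e (c s)) has_vector_derivative
      dir_deriv (dir_deriv S e) (axis 2 1) (c s)) (at s)" for e s
    using smooth by (intro has_vector_derivative_along_curve c' smooth_differentiable smooth_dir_deriv)
  \<comment> \<open>The product rule would also give \<open>s\<close> times a mixed second
    derivative; this term vanishes at \<open>s = 0\<close>.\<close>
  have "((\<lambda>s. s *\<^sub>R dir_deriv S (axis 1 1) (c s)) has_vector_derivative
      dir_deriv S (axis 1 1) (c 0)) (at 0)"
    by (auto intro!: derivative_eq_intros D)
  moreover have "((\<lambda>s. t *\<^sub>R dir_deriv S (axis 2 1) (c s)) has_vector_derivative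
      t *\<^sub>R dir_deriv (dir_deriv S (axis 2 1)) (axis 2 1) (c 0)) (at 0)"
    by (auto intro!: derivative_eq_intros D)
  moreover have "s *\<^sub>R dir_deriv S (axis 1 1) (c s) = t *\<^sub>R dir_deriv S (axis 2 1) (c s)" for s
    using radially_symmetric_rotation[OF rad smooth_differentiable[OF smooth], of "c s"]
    by (simp add: c)
  ultimately show ?thesis
    using vector_derivative_unique_at by (simp add: c(3))
qed

text \<open>\<open>tangential_part p\<close> is additive, so the projection can be taken once, after
  summing the ambient second derivatives.\<close>

lemma tension_field_eq:
  "tension_field S x =
     tangential_part (S x) (dir_deriv (dir_deriv S (axis 1 1)) (axis 1 1) x +
                            dir_deriv (dir_deriv S (axis 2 1)) (axis 2 1) x)"
proof -
  interpret bounded_bilinear minkowski by (rule bounded_bilinear_minkowski)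
  have B: "(Basis :: (real ^ 2) set) = {axis 1 1, axis 2 1}"
    by (auto simp: Basis_vec_def UNIV_2)
  have "axis 1 1 \<noteq> (axis 2 1 :: real ^ 2)"
    by (simp add: axis_eq_axis)
  then show ?thesis
    by (simp add: tension_field_def B cov_deriv_def tangential_part_def add_right algebra_simps)
qed

lemma radial_harmonic_deriv_eq_0:
  fixes S :: "real ^ 2 \<Rightarrow> real ^ 3"
  assumes S: "\<And>x. S x \<in> hyperbolic_plane" and smooth: "smooth S"
    and harm: "harmonic_map S" and rad: "radially_symmetric S"
  shows "dir_deriv S (axis 1 1) (t *\<^sub>R axis 1 1) = 0"
proof -
  interpret bounded_bilinear minkowski by (rule bounded_bilinear_minkowski)
  define F where "F t = S (t *\<^sub>R axis 1 1)" for t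
  define F' where "F' t = dir_deriv S (axis 1 1) (t *\<^sub>R axis 1 1)" for t
  define F'' where "F'' t = dir_deriv (dir_deriv S (axis 1 1)) (axis 1 1) (t *\<^sub>R axis 1 1)" for t
  define A where "A t = dir_deriv (dir_deriv S (axis 2 1)) (axis 2 1) (t *\<^sub>R axis 1 1)" for t
  have tang: "F' t \<in> tangent_space (F t)" for t
    unfolding F_def F'_def using smooth by (intro dir_deriv_in_tangent_space S smooth_differentiable)
  then have orth: "minkowski (F' t) (F t) = 0" for t
    by (simp add: tangent_space_def minkowski_commute[of "F' t"])
  have ang: "F' t = t *\<^sub>R A t" for t
    unfolding F'_def A_def by (rule radially_symmetric_angular_second_derivative[OF smooth rad])
  have "tangential_part (F t) (F'' t + A t) = 0" for t
    using harm unfolding harmonic_map_def tension_field_eq F_def F''_def A_def by blast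
  \<comment> \<open>Pairing with the tangent vector \<open>F' t\<close> kills the multiple of
    \<open>F t\<close> that the projection adds, leaving only ambient derivatives.\<close>
  then have "minkowski (F' t) (tangential_part (F t) (F'' t + A t)) = 0" for t
    by (simp add: zero_right)
  then have "minkowski (F' t) (F'' t) + minkowski (F' t) (A t) = 0" for t
    by (simp add: tangential_part_def add_right scaleR_right orth)
  \<comment> \<open>The factor \<open>t\<close> turns \<open>A t\<close> into \<open>F' t\<close> by
    \<open>ang\<close>; no division by \<open>t\<close> is needed, so the equation also holds at the
    origin.\<close>
  then have "t * (minkowski (F' t) (F'' t) + minkowski (F' t) (A t)) = 0" for t
    by simp
  then have ode: "t * minkowski (F' t) (F'' t) + minkowski (F' t) (F' t) = 0" for t
    using scaleR_right[of "F' t" t "A t"] by (simp add: ang[symmetric] algebra_simps)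
  have DF': "(F' has_vector_derivative F'' t) (at t)" for t
    unfolding F'_def F''_def using smooth
    by (intro has_vector_derivative_along_curve smooth_differentiable smooth_dir_deriv)
       (auto intro!: derivative_eq_intros)
  have "((\<lambda>t. t\<^sup>2 * minkowski (F' t) (F' t)) has_vector_derivative 0) (at t)" for t
  proof -
    have "((\<lambda>t. minkowski (F' t) (F' t)) has_vector_derivative 2 * minkowski (F' t) (F'' t)) (at t)"
      using has_vector_derivative[OF DF' DF', of t]
      by (simp add: minkowski_commute[of "F'' t"])
    then have "((\<lambda>t. t\<^sup>2 * minkowski (F' t) (F' t)) has_field_derivative
        2 * t * minkowski (F' t) (F' t) + t\<^sup>2 * (2 * minkowski (F' t) (F'' t))) (at t)"
      unfolding has_real_derivative_iff_has_vector_derivative[symmetric]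
      by (auto intro!: derivative_eq_intros)
    \<comment> \<open>The weight \<open>t\<^sup>2\<close> is the integrating factor: the derivative
      is \<open>2 * t\<close> times the left-hand side of \<open>ode\<close>.\<close>
    also have "2 * t * minkowski (F' t) (F' t) + t\<^sup>2 * (2 * minkowski (F' t) (F'' t)) =
        2 * t * (t * minkowski (F' t) (F'' t) + minkowski (F' t) (F' t))"
      by (simp add: power2_eq_square algebra_simps)
    finally show ?thesis
      by (simp add: ode has_real_derivative_iff_has_vector_derivative)
  qed
  then have "t\<^sup>2 * minkowski (F' t) (F' t) = 0\<^sup>2 * minkowski (F' 0) (F' 0)"
    by (intro DERIV_isconst_all) (simp add: has_real_derivative_iff_has_vector_derivative)
  \<comment> \<open>For nonzero \<open>t\<close> the vector \<open>F' t\<close> is null and tangent,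
    hence zero. At \<open>t = 0\<close> the weight gives no information, but there
    \<open>ang\<close> reads \<open>F' 0 = 0\<close>.\<close>
  then have "F' t = 0"
    using minkowski_null_tangent_eq_0[OF _ tang, of t] S ang[of t] by (auto simp: F_def)
  then show ?thesis by (simp add: F'_def)
qed

theorem theorem3:
  shows "\<not> (\<exists>S :: real ^ 2 \<Rightarrow> real ^ 3.
           (\<forall>x. S x \<in> hyperbolic_plane) \<and> smooth S \<and> harmonic_map S \<and> radially_symmetric S \<and>
           \<not> S constant_on UNIV)"
proof safe
  fix S :: "real ^ 2 \<Rightarrow> real ^ 3"
  assume S: "\<forall>x. S x \<in> hyperbolic_plane" "smooth S" "harmonic_map S" and rad: "radially_symmetric S"
    and "\<not> S constant_on UNIV"
  have "((\<lambda>t. S (t *\<^sub>R axis 1 1)) has_vector_derivative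
      dir_deriv S (axis 1 1) (t *\<^sub>R axis 1 1)) (at t)" for t
    using S(2) by (intro has_vector_derivative_along_curve smooth_differentiable)
      (auto intro!: derivative_eq_intros)
  then have "((\<lambda>t. S (t *\<^sub>R axis 1 1)) has_vector_derivative 0) (at t within UNIV)" for t
    using radial_harmonic_deriv_eq_0[of S] S rad by simp
  then obtain k where k: "S (t *\<^sub>R axis 1 1) = k" for t
    using has_vector_derivative_zero_constant[of UNIV "\<lambda>t. S (t *\<^sub>R axis 1 1)"] by auto
  \<comment> \<open>Every circle about the origin meets the first axis, so constancy on the axis
    spreads to the plane by radial symmetry.\<close>
  have "norm (norm x *\<^sub>R axis 1 1 :: real ^ 2) = norm x" for x :: "real ^ 2"
    by (simp add: norm_axis_1)
  then have "S x = k" for x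
    using rad k by (metis radially_symmetric_def)
  then have "S constant_on UNIV"
    by (auto simp: constant_on_def)
  with \<open>\<not> S constant_on UNIV\<close> show False ..
qed

end
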